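(* Let $d\in\mathbb N$, $p\in[1,2)$ and let $V\subseteq C^{2^-\text{-var}}(\mathbb R^d)$ be a path variety. If $(X_n)_n$ is a sequence of paths in $V$ (on a common time interval $[0,T]$) of bounded $p$-variation which converges in $p$-variation norm to a path $X:[0,T]\to\mathbb R^d$ of bounded $p$-variation (i.e. $\|X_n-X\|_{p\text{-var}}\to0$), then $X\in V$.
   Context: For $d\in\mathbb N$, $C^{2^-\text{-var}}(\mathbb R^d)$ is the set of all continuous $X:[0,T]\to\mathbb R^d$, with $T\in(0,\infty)$ depending on $X$, that have finite $p$-variation for some $p\in[1,2)$, where $\|X\|_{p\text{-var}}=\big(\sup_P\sum_{[s,t]\in P}\|X_t-X_s\|_2^p\big)^{1/p}$ (supremum over partitions $P$ of $[0,T]$). Its elements are called paths (in particular all paths are continuous). $T(\mathbb R^d)=\bigoplus_{n\ge0}(\mathbb R^d)^{\otimes n}$ is identified with the real vector space spanned by the words in the letters $1,\dots,d$, including the empty word $\mathsf e$; $T((\mathbb R^d))$ is its linear dual. The signature $\sigma(X)\in T((\mathbb R^d))$ of a path $X$ with components $X^{[i]}$ is given by $\langle\sigma(X),\mathsf e\rangle=1$ and the iterated Riemann–Stieltjes integrals $\langle\sigma(X),i_1\cdots i_n\rangle=\int_{0<t_1<\dots<t_n<T}dX^{[i_1]}_{t_1}\cdots dX^{[i_n]}_{t_n}$. A path variety is a set of the form $\mathcal V(W)=\{X\in C^{2^-\text{-var}}(\mathbb R^d)\mid\langle\sigma(X),x\rangle=0\ \forall x\in W\}$ with $W\subseteq T(\mathbb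 R^d)$. *)

theory Defs
  imports "HOL-Analysis.Analysis" "HOL-Library.Poly_Mapping"
begin

section \<open>Paths of finite p-variation\<close>

text \<open>
  A partition of \<open>[0,T]\<close> is a \<open>division_of {0..T}\<close>; an interval \<open>[s,t]\<close> of it is recovered
  as \<open>s = Inf K\<close>, \<open>t = Sup K\<close>. A division may also contain one-point intervals, which
  contribute \<open>0 powr p = 0\<close>. The value is in \<^typ>\<open>ennreal\<close>, so that an infinite \<open>p\<close>-variation
  is \<^const>\<open>top\<close>.
\<close>

definition pvar :: "real \<Rightarrow> real \<Rightarrow> (real \<Rightarrow> 'a::real_normed_vector) \<Rightarrow> ennreal" where
  "pvar p T X =
     (let S = (SUP P \<in> {P. P division_of {0..T}}.
                 ennreal (\<Sum>K\<in>P. norm (X (Sup K) - X (Inf K)) powr p))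
      in if S = top then top else ennreal (enn2real S powr (1 / p)))"

text \<open>
  A map \<open>[0,T] \<rightarrow> \<real>\<^sup>d\<close> is a pair \<open>(T, X)\<close> where \<open>X\<close> is normalised to \<^const>\<open>undefined\<close> outside
  \<open>[0,T]\<close>, so that pairs are equal exactly if the maps are. The letters \<open>1,\<dots>,d\<close> are the elements of
  the finite index type \<open>'d\<close>.
\<close>

definition paths :: "(real \<times> (real \<Rightarrow> real ^ 'd::finite)) set" where
  "paths = {(T, X). 0 < T \<and> X \<in> extensional {0..T} \<and> continuous_on {0..T} X \<and>
                    (\<exists>p. 1 \<le> p \<and> p < 2 \<and> pvar p T X < top)}"

section \<open>Signatures\<close>

text \<open>
  The integral of \<open>f\<close> against \<open>g\<close> as the limit of Riemann--Stieltjes sums, with arbitrary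
  evaluation points, as the mesh tends to zero.
\<close>

definition has_rs_integral ::
  "(real \<Rightarrow> real) \<Rightarrow> (real \<Rightarrow> real) \<Rightarrow> real \<Rightarrow> real \<Rightarrow> real \<Rightarrow> bool" where
  "has_rs_integral f g a b I \<longleftrightarrow>
     (\<forall>\<epsilon>>0. \<exists>\<delta>>0. \<forall>D. D tagged_division_of {a..b} \<and> (\<forall>(\<xi>, K)\<in>D. Sup K - Inf K < \<delta>) \<longrightarrow>
        \<bar>(\<Sum>(\<xi>, K)\<in>D. f \<xi> * (g (Sup K) - g (Inf K))) - I\<bar> < \<epsilon>)"

definition rs_integral ::
  "(real \<Rightarrow> real) \<Rightarrow> (real \<Rightarrow> real) \<Rightarrow> real \<Rightarrow> real \<Rightarrow> real" where
  "rs_integral f g a b = (THE I. has_rs_integral f g a b I)"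

text \<open>
  \<open>iterated_integral X [i\<^sub>n, \<dots>, i\<^sub>1] t\<close> is the integral of
  \<open>dX\<^bsup>[i\<^sub>1]\<^esup> \<cdots> dX\<^bsup>[i\<^sub>n]\<^esup>\<close> over \<open>0 < t\<^sub>1 < \<cdots> < t\<^sub>n < t\<close>: the word is read backwards, since the
  last letter belongs to the outermost integral. The integrals exist for all elements
  of \<^const>\<open>paths\<close>, by Young's theorem.
\<close>

primrec iterated_integral :: "(real \<Rightarrow> real ^ 'd::finite) \<Rightarrow> 'd list \<Rightarrow> real \<Rightarrow> real" where
  "iterated_integral X [] = (\<lambda>t. 1)"
| "iterated_integral X (i # w) =
     (\<lambda>t. rs_integral (iterated_integral X w) (\<lambda>s. X s $ i) 0 t)"

text \<open>
  \<open>T(\<real>\<^sup>d)\<close>, with its basis of words, is the type \<^typ>\<open>'d list \<Rightarrow>\<^sub>0 real\<close> of finitely supported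
  coefficient functions. An element of the dual \<open>T((\<real>\<^sup>d))\<close> is given by its values on words.
\<close>

definition signature :: "real \<times> (real \<Rightarrow> real ^ 'd::finite) \<Rightarrow> 'd list \<Rightarrow> real" where
  "signature = (\<lambda>(T, X) w. iterated_integral X (rev w) T)"

definition pairing :: "('d list \<Rightarrow> real) \<Rightarrow> ('d list \<Rightarrow>\<^sub>0 real) \<Rightarrow> real" where
  "pairing a x = (\<Sum>w\<in>Poly_Mapping.keys x. Poly_Mapping.lookup x w * a w)"

section \<open>Path varieties\<close>

definition variety ::
  "('d::finite list \<Rightarrow>\<^sub>0 real) set \<Rightarrow> (real \<times> (real \<Rightarrow> real ^ 'd)) set" where
  "variety W = {X \<in> paths. \<forall>x\<in>W. pairing (signature X) x = 0}"

definition path_variety :: "(real \<times> (real \<Rightarrow> real ^ 'd::finite)) set \<Rightarrow> bool" where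
  "path_variety V \<longleftrightarrow> (\<exists>W. V = variety W)"

end

theory Submission
  imports Defs
begin

text \<open>
  Every letter of a word contributes one Young integration, and Young integration is a bounded
  bilinear map in \<open>p\<close>-variation: the Loeve--Young inequality bounds the \<open>p\<close>-variation of
  \<open>\<integral>f dg\<close> by a constant times that of \<open>f\<close> (plus \<open>\<bar>f 0\<bar>\<close>) times that of \<open>g\<close>. By induction on the word,
  convergence of paths in \<open>p\<close>-variation implies convergence of all iterated integrals, so each
  coordinate of the signature is continuous and path varieties are closed.
\<close>

section \<open>The Loeve--Young inequality for left-point sums\<close>

text \<open>The obstacle is that a control enters only as a monotone function \<open>W\<close>,
  whose continuity is not recorded: a fine mesh need not make its increments small, so the exponent
  2/p > 1 alone gives no convergence. Smallness is taken from the continuity of the integrand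
  instead. Part of the power of an increment of \<open>f\<close> is traded for its oscillation,
  which leaves the exponent 1/p + 1/2, still above 1 because p < 2. Every estimate is then a factor
  \<open>A\<close> times a power of an increment of \<open>W\<close>, with \<open>A\<close> fixed
  for bounds and arbitrarily small on short intervals for limits. Since \<open>rs_integral\<close>
  is a definite description, no algebra with it is possible before existence and uniqueness are
  known; dyadic sums supply the candidate value.\<close>

definition young_const :: "real \<Rightarrow> real" where
  "young_const \<theta> = 2 / (1 - 2 powr (1 - \<theta>))"

text \<open>The constant is the fixed point of C = 2 powr (1 - \<theta>) * C + 2: halving the
  control on two pieces turns C into twice C * (1/2) powr \<theta>, and two cross terms are
  added.\<close>

lemma young_const:
  assumes "1 < \<theta>"
  shows "0 < young_const \<theta>" "young_const \<theta> * 2 powr (1 - \<theta>) + 2 = young_const \<theta>"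
proof -
  have "2 powr (1 - \<theta>) < 2 powr (0::real)"
    using assms by (intro powr_less_mono) auto
  then have "1 - 2 powr (1 - \<theta>) > 0" by simp
  then show "0 < young_const \<theta>" "young_const \<theta> * 2 powr (1 - \<theta>) + 2 = young_const \<theta>"
    by (auto simp: young_const_def divide_simps)
qed

text \<open>Bisecting the control rather than the index set closes the recursion with a constant
  independent of the number of points. The hypothesis bounds products of adjacent increments, so a
  small factor \<open>A\<close> may come from either function.\<close>

lemma young_discrete:
  fixes x y w :: "nat \<Rightarrow> real"
  assumes "1 < \<theta>" "0 \<le> A" "mono_on {a..b} w" "a \<le> b"
    and "\<And>i j k. a \<le> i \<Longrightarrow> i \<le> j \<Longrightarrow> j \<le> k \<Longrightarrow> k \<le> b \<Longrightarrow>
           \<bar>x j - x i\<bar> * \<bar>y k - y j\<bar> \<le> A * (w k - w i) powr \<theta>"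
  shows "\<bar>(\<Sum>i=a..<b. x i * (y (Suc i) - y i)) - x a * (y b - y a)\<bar>
           \<le> young_const \<theta> * A * (w b - w a) powr \<theta>"
  using assms(3-)
proof (induction "b - a" arbitrary: a b rule: less_induct)
  case less
  note C = young_const[OF assms(1)]
  have mono: "w i \<le> w j" if "a \<le> i" "i \<le> j" "j \<le> b" for i j
    using less.prems(1) that by (auto simp: mono_on_def)
  show ?case
  proof (cases "b \<le> Suc a")
    case True
    then have "b = a \<or> b = Suc a" using less.prems(2) by auto
    then show ?thesis using C assms by auto
  next
    case False
    \<comment> \<open>Split at the last index with at most half of the control to its left; then at most half
      of the control lies to the right of its successor, and \<open>\<theta> > 1\<close> makes the two halves contract.\<close>
    define \<Omega> where "\<Omega> = w b - w a"
    have \<Omega>: "0 \<le> \<Omega>" using mono[of a b] less.prems by (simp add: \<Omega>_def)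
    define I where "I = {i \<in> {a..<b}. w i - w a \<le> \<Omega> / 2}"
    have I: "finite I" "I \<noteq> {}" using False \<Omega> by (auto simp: I_def intro: exI[of _ a])
    define i where "i = Max I"
    have iI: "i \<in> I" unfolding i_def using I by (rule Max_in)
    have i: "a \<le> i" "i < b" "w i - w a \<le> \<Omega> / 2" using iI by (auto simp: I_def)
    have i': "w b - w (Suc i) \<le> \<Omega> / 2"
    proof (cases "Suc i = b")
      case True
      then show ?thesis using \<Omega> by simp
    next
      case False
      have "Suc i \<notin> I" using Max_ge[OF I(1), of "Suc i"] by (auto simp: i_def)
      with False i have "w (Suc i) - w a > \<Omega> / 2" by (auto simp: I_def)
      then show ?thesis by (simp add: \<Omega>_def field_simps)
    qed
    let ?s = "\<lambda>a b. \<Sum>i=a..<b. x i * (y (Suc i) - y i)"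
    let ?R = "\<lambda>a b. ?s a b - x a * (y b - y a)"
    have half: "young_const \<theta> * A * v powr \<theta> \<le> young_const \<theta> * A * (\<Omega> / 2) powr \<theta>"
      if "0 \<le> v" "v \<le> \<Omega> / 2" for v
      using that C assms(1,2) by (intro mult_left_mono powr_mono2) auto
    have "\<bar>?R a i\<bar> \<le> young_const \<theta> * A * (w i - w a) powr \<theta>"
      using i less.prems by (intro less.hyps) (auto simp: mono_on_def)
    also have "\<dots> \<le> young_const \<theta> * A * (\<Omega> / 2) powr \<theta>"
      using i mono[of a i] by (intro half) auto
    finally have 1: "\<bar>?R a i\<bar> \<le> young_const \<theta> * A * (\<Omega> / 2) powr \<theta>" .
    have "\<bar>?R (Suc i) b\<bar> \<le> young_const \<theta> * A * (w b - w (Suc i)) powr \<theta>"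
      using i less.prems by (intro less.hyps) (auto simp: mono_on_def)
    also have "\<dots> \<le> young_const \<theta> * A * (\<Omega> / 2) powr \<theta>"
      using i i' mono[of "Suc i" b] by (intro half) auto
    finally have 2: "\<bar>?R (Suc i) b\<bar> \<le> young_const \<theta> * A * (\<Omega> / 2) powr \<theta>" .
    \<comment> \<open>The step from \<open>i\<close> to \<open>Suc i\<close> crosses the middle of
      the control and belongs to neither half. Moving its base value and that of the right half to
      \<open>x a\<close> produces the two cross terms.\<close>
    have "\<bar>x i - x a\<bar> * \<bar>y (Suc i) - y i\<bar> \<le> A * (w (Suc i) - w a) powr \<theta>"
      using i by (intro less.prems) auto
    also have "\<dots> \<le> A * \<Omega> powr \<theta>"
      using i mono[of "Suc i" b] mono[of a "Suc i"] assms(1,2)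
      by (intro mult_left_mono powr_mono2) (auto simp: \<Omega>_def)
    finally have 3: "\<bar>(x i - x a) * (y (Suc i) - y i)\<bar> \<le> A * \<Omega> powr \<theta>"
      by (simp add: abs_mult)
    have 4: "\<bar>(x (Suc i) - x a) * (y b - y (Suc i))\<bar> \<le> A * \<Omega> powr \<theta>"
      unfolding abs_mult \<Omega>_def using i by (intro less.prems) auto
    have "?s a b = ?s a i + ?s i b"
      using i by (simp add: sum.atLeastLessThan_concat)
    also have "?s i b = x i * (y (Suc i) - y i) + ?s (Suc i) b"
      using i by (subst sum.atLeast_Suc_lessThan) auto
    finally have "?R a b = ?R a i + ?R (Suc i) b + (x i - x a) * (y (Suc i) - y i)
                     + (x (Suc i) - x a) * (y b - y (Suc i))"
      by (simp add: algebra_simps)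
    then have "\<bar>?R a b\<bar> \<le> 2 * (young_const \<theta> * A * (\<Omega> / 2) powr \<theta>) + 2 * (A * \<Omega> powr \<theta>)"
      using 1 2 3 4 by linarith
    also have "\<dots> = (young_const \<theta> * 2 powr (1 - \<theta>) + 2) * (A * \<Omega> powr \<theta>)"
      using \<Omega> by (simp add: powr_divide powr_diff algebra_simps)
    also have "\<dots> = young_const \<theta> * A * \<Omega> powr \<theta>"
      unfolding C by simp
    finally show ?thesis unfolding \<Omega>_def .
  qed
qed

section \<open>Dyadic left-point sums\<close>

definition dyadic_sum :: "real \<Rightarrow> (real \<Rightarrow> real) \<Rightarrow> (real \<Rightarrow> real) \<Rightarrow> nat \<Rightarrow> real \<Rightarrow> real" where
  "dyadic_sum T f g n t = (\<Sum>i<2^n. f (T * real i / 2^n) *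
     (g (min t (T * real (Suc i) / 2^n)) - g (min t (T * real i / 2^n))))"

text \<open>Stopping both ends of each cell at \<open>t\<close> keeps the grid independent of
  \<open>t\<close>, so sums for different times can be subtracted term by term; at time 0 every
  increment of \<open>g\<close> collapses.\<close>

lemma dyadic_sum_zero: "0 < T \<Longrightarrow> dyadic_sum T f g n 0 = 0"
  by (simp add: dyadic_sum_def min_def not_le)

text \<open>The points \<open>u\<close> and \<open>v\<close> are unrelated, so the increments may
  overlap. This serves arbitrary tags: moving a tag \<open>u\<close> to the left end
  \<open>s\<close> costs the increment of \<open>f\<close> times that of \<open>g\<close> over the
  whole cell, the case \<open>v = s\<close>.\<close>

definition young_on :: "real \<Rightarrow> real \<Rightarrow> (real \<Rightarrow> real) \<Rightarrow> (real \<Rightarrow> real) \<Rightarrow>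
    (real \<Rightarrow> real) \<Rightarrow> real \<Rightarrow> real \<Rightarrow> bool" where
  "young_on \<theta> A W f g a b \<longleftrightarrow>
     (\<forall>s u v t. a \<le> s \<and> s \<le> u \<and> u \<le> t \<and> s \<le> v \<and> v \<le> t \<and> t \<le> b \<longrightarrow>
        \<bar>f u - f s\<bar> * \<bar>g t - g v\<bar> \<le> A * (W t - W s) powr \<theta>)"

text \<open>The cell containing \<open>s\<close> begins at a grid point \<open>u\<close> that may
  lie before \<open>s\<close>, so the sum uses \<open>f u\<close> where the estimate wants
  \<open>f s\<close>. This single mismatch is the extra error term.\<close>

lemma dyadic_sum_young:
  fixes n :: nat
  assumes "0 < T" "1 < \<theta>" "0 \<le> A" "mono_on {0..T} W" "0 \<le> s" "s \<le> t" "t \<le> T"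
    and y: "young_on \<theta> A W f g s t"
  defines "u \<equiv> T * real (nat \<lfloor>s * 2^n / T\<rfloor>) / 2^n"
  obtains v where "s \<le> v" "v \<le> t"
    "\<bar>dyadic_sum T f g n t - dyadic_sum T f g n s - f s * (g t - g s)\<bar>
      \<le> young_const \<theta> * A * (W t - W s) powr \<theta> + \<bar>f u - f s\<bar> * \<bar>g v - g s\<bar>"
proof -
  define r where "r i = T * real i / 2^n" for i
  define k where "k = nat \<lfloor>s * 2^n / T\<rfloor>"
  have u: "u = r k" by (simp add: u_def k_def r_def)
  have k: "real k \<le> s * 2^n / T" "s * 2^n / T < real k + 1"
    using assms by (simp_all add: k_def)
  have rk: "r k \<le> s" "s < r (Suc k)"
    using k assms(1) by (simp_all add: r_def field_simps)
  have rmono: "r i \<le> r j" if "i \<le> j" for i j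
    using that assms(1) by (simp add: r_def divide_right_mono)
  \<comment> \<open>The grid clamped to [s,t]. The difference of the two stopped sums runs over
    these points, and \<open>young_discrete\<close> applies once \<open>f\<close> is evaluated there
    too.\<close>
  define \<sigma> where "\<sigma> i = max s (min t (r i))" for i
  have \<sigma>: "s \<le> \<sigma> i" "\<sigma> i \<le> t" for i using assms by (auto simp: \<sigma>_def)
  have \<sigma>mono: "\<sigma> i \<le> \<sigma> j" if "i \<le> j" for i j
    using rmono[OF that] by (auto simp: \<sigma>_def)
  have \<sigma>ends: "\<sigma> 0 = s" "\<sigma> (2^n) = t"
    using assms by (auto simp: \<sigma>_def r_def)
  let ?G = "\<Sum>i<2^n. f (\<sigma> i) * (g (\<sigma> (Suc i)) - g (\<sigma> i))"
  have "\<bar>(\<Sum>i=0..<2^n. f (\<sigma> i) * (g (\<sigma> (Suc i)) - g (\<sigma> i))) - f (\<sigma> 0) * (g (\<sigma> (2^n)) - g (\<sigma> 0))\<bar>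
      \<le> young_const \<theta> * A * (W (\<sigma> (2^n)) - W (\<sigma> 0)) powr \<theta>"
    using assms(2,3)
  proof (rule young_discrete)
    show "mono_on {0..2 ^ n} (\<lambda>i. W (\<sigma> i))"
      by (intro mono_onI mono_onD[OF assms(4)] \<sigma>mono)
         (use \<sigma> assms(5-7) in \<open>auto intro: order_trans\<close>)
    fix i j k assume "0 \<le> i" "i \<le> j" "j \<le> k" "k \<le> (2::nat)^n"
    then show "\<bar>f (\<sigma> j) - f (\<sigma> i)\<bar> * \<bar>g (\<sigma> k) - g (\<sigma> j)\<bar> \<le> A * (W (\<sigma> k) - W (\<sigma> i)) powr \<theta>"
      using \<sigma>[of i] \<sigma>[of k] \<sigma>mono[of i j] \<sigma>mono[of j k]
      by (intro y[unfolded young_on_def, rule_format]) auto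
  qed auto
  then have G: "\<bar>?G - f s * (g t - g s)\<bar> \<le> young_const \<theta> * A * (W t - W s) powr \<theta>"
    by (simp add: \<sigma>ends lessThan_atLeast0)
  have split: "g (min t z) - g (min s z) = g (max s (min t z)) - g s" for z
    using assms by (auto simp: min_def max_def)
  have "f (r i) * (g (min t (r (Suc i))) - g (min t (r i))) -
      f (r i) * (g (min s (r (Suc i))) - g (min s (r i))) = f (r i) * (g (\<sigma> (Suc i)) - g (\<sigma> i))" for i
    using split[of "r i"] split[of "r (Suc i)"]
    unfolding \<sigma>_def right_diff_distrib[symmetric] by simp
  then have "dyadic_sum T f g n t - dyadic_sum T f g n s =
      (\<Sum>i<2^n. f (r i) * (g (\<sigma> (Suc i)) - g (\<sigma> i)))"
    unfolding dyadic_sum_def sum_subtractf[symmetric] r_def by (intro sum.cong refl)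
  then have "dyadic_sum T f g n t - dyadic_sum T f g n s - ?G =
      (\<Sum>i<2^n. (f (r i) - f (\<sigma> i)) * (g (\<sigma> (Suc i)) - g (\<sigma> i)))"
    by (simp only: sum_subtractf left_diff_distrib)
  \<comment> \<open>Cells before \<open>k\<close> collapse to \<open>s\<close>; cells after
    \<open>k\<close> start at an unclamped grid point or collapse to \<open>t\<close>. Only the cell
    of \<open>s\<close> sees the change of evaluation point.\<close>
  also have "\<dots> = (\<Sum>i<2^n. if i = k then (f (r k) - f s) * (g (\<sigma> (Suc k)) - g s) else 0)"
  proof (intro sum.cong refl)
    fix i assume "i \<in> {..<(2::nat)^n}"
    consider "i < k" | "i = k" | "k < i" by linarith
    then show "(f (r i) - f (\<sigma> i)) * (g (\<sigma> (Suc i)) - g (\<sigma> i)) =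
        (if i = k then (f (r k) - f s) * (g (\<sigma> (Suc k)) - g s) else 0)"
    proof cases
      case 1
      then have "r (Suc i) \<le> s" "r i \<le> s" using rmono[of "Suc i" k] rmono[of i k] rk by auto
      then have "\<sigma> (Suc i) = s" "\<sigma> i = s" by (auto simp: \<sigma>_def)
      then show ?thesis using 1 by simp
    next
      case 2
      then show ?thesis using rk assms by (auto simp: \<sigma>_def)
    next
      case 3
      then have "s \<le> r i" using rmono[of "Suc k" i] rk by auto
      moreover have "r i \<le> r (Suc i)" by (rule rmono) simp
      ultimately have "\<sigma> i = r i \<or> \<sigma> (Suc i) = \<sigma> i"
        using assms by (auto simp: \<sigma>_def)
      then show ?thesis using 3 by auto
    qed
  qed
  \<comment> \<open>The index \<open>k\<close> reaches 2^n when \<open>s = T\<close>; then no cell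
    contributes.\<close>
  finally have D: "dyadic_sum T f g n t - dyadic_sum T f g n s - ?G =
      (if k < 2^n then (f (r k) - f s) * (g (\<sigma> (Suc k)) - g s) else 0)"
    by (simp split: if_splits)
  have "\<bar>dyadic_sum T f g n t - dyadic_sum T f g n s - ?G\<bar> \<le> \<bar>f u - f s\<bar> * \<bar>g (\<sigma> (Suc k)) - g s\<bar>"
    unfolding D u by (auto simp: abs_mult)
  with G show ?thesis
    by (intro that[of "\<sigma> (Suc k)"] \<sigma>) linarith
qed

text \<open>A point of the grid of level \<open>n\<close> lies on every finer grid, so
  \<open>u = s\<close> and the error term disappears.\<close>

lemma dyadic_sum_young_grid:
  fixes m n i :: nat
  assumes "0 < T" "1 < \<theta>" "0 \<le> A" "mono_on {0..T} W" "0 \<le> s" "s \<le> t" "t \<le> T"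
    and "young_on \<theta> A W f g s t" "n \<le> m" "s = T * real i / 2^n"
  shows "\<bar>dyadic_sum T f g m t - dyadic_sum T f g m s - f s * (g t - g s)\<bar>
      \<le> young_const \<theta> * A * (W t - W s) powr \<theta>"
proof -
  have pow: "(2::real)^m = 2^(m-n) * 2^n"
    using \<open>n \<le> m\<close> by (simp flip: power_add)
  have "s * 2^m / T = real (i * 2^(m-n))"
    using assms(1,10) by (simp add: pow)
  then have "nat \<lfloor>s * 2^m / T\<rfloor> = i * 2^(m-n)"
    by (metis floor_of_nat nat_int)
  then have "T * real (nat \<lfloor>s * 2^m / T\<rfloor>) / 2^m = s"
    using assms(10) by (simp add: pow)
  then show ?thesis
    using dyadic_sum_young[OF assms(1-8), of m] by auto
qed

lemma young_on_mono:
  "young_on \<theta> A W f g a b \<Longrightarrow> A \<le> B \<Longrightarrow> young_on \<theta> B W f g a b"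
  unfolding young_on_def by (meson mult_right_mono order_trans powr_ge_zero)

lemma young_on_subset:
  "young_on \<theta> A W f g a b \<Longrightarrow> a \<le> a' \<Longrightarrow> b' \<le> b \<Longrightarrow> young_on \<theta> A W f g a' b'"
  unfolding young_on_def by (meson order_trans)

section \<open>The Young integral\<close>

text \<open>One \<open>W\<close> controls both functions, normalised to total increase at most 1 so
  that larger exponents give smaller powers. Sizes are carried by \<open>M\<close> and
  \<open>L\<close>, which keeps the final bound bilinear.\<close>

locale young_pair =
  fixes p T M L :: real and f g W :: "real \<Rightarrow> real"
  assumes p: "1 \<le> p" "p < 2" and T: "0 < T" and M: "0 \<le> M" and L: "0 \<le> L"
    and f_cont: "continuous_on {0..T} f" and g_cont: "continuous_on {0..T} g"
    and W_mono: "mono_on {0..T} W" and W_le: "W T - W 0 \<le> 1"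
    and f_bound: "\<And>s t. 0 \<le> s \<Longrightarrow> s \<le> t \<Longrightarrow> t \<le> T \<Longrightarrow> \<bar>f t - f s\<bar> \<le> M * (W t - W s) powr (1 / p)"
    and g_bound: "\<And>s t. 0 \<le> s \<Longrightarrow> s \<le> t \<Longrightarrow> t \<le> T \<Longrightarrow> \<bar>g t - g s\<bar> \<le> L * (W t - W s) powr (1 / p)"
begin

text \<open>Of the available 2/p, \<open>g\<close> keeps 1/p and \<open>f\<close> keeps only 1/2.
  The rest of the power of \<open>f\<close>, positive for p < 2, is spent on its
  oscillation.\<close>

definition \<theta> :: real where "\<theta> = 1 / p + 1 / 2"

lemma \<theta>: "1 < \<theta>" "1 / p \<le> \<theta>" using p by (auto simp: \<theta>_def field_simps)

abbreviation (input) C where "C \<equiv> young_const \<theta>"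

lemmas C = young_const(1)[OF \<theta>(1)]

lemma W_increment:
  assumes "0 \<le> s" "s \<le> t" "t \<le> T"
  shows "0 \<le> W t - W s" "W t - W s \<le> 1"
proof -
  have "W 0 \<le> W s" "W s \<le> W t" "W t \<le> W T"
    using assms T by (auto intro!: mono_onD[OF W_mono])
  then show "0 \<le> W t - W s" "W t - W s \<le> 1" using W_le by auto
qed

lemma W_increment_powr_le:
  assumes "0 \<le> s" "s \<le> t" "t \<le> T"
  shows "(W t - W s) powr \<theta> \<le> W t - W s" "(W t - W s) powr \<theta> \<le> (W t - W s) powr (1 / p)"
    "(W t - W s) powr (1 / p) \<le> 1"
proof -
  show "(W t - W s) powr \<theta> \<le> W t - W s"
    using W_increment[OF assms] \<theta> powr_mono'[of 1 \<theta> "W t - W s"] by simp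
  show "(W t - W s) powr \<theta> \<le> (W t - W s) powr (1 / p)"
    using W_increment[OF assms] \<theta> by (intro powr_mono') auto
  show "(W t - W s) powr (1 / p) \<le> 1"
    using W_increment[OF assms] p by (intro powr_le1) auto
qed

lemma g_le: "0 \<le> s \<Longrightarrow> s \<le> t \<Longrightarrow> t \<le> T \<Longrightarrow> \<bar>g t - g s\<bar> \<le> L"
  using g_bound[of s t] W_increment_powr_le(3)[of s t] L
  by (meson mult_left_le order_trans)

lemma f_le: "0 \<le> s \<Longrightarrow> s \<le> t \<Longrightarrow> t \<le> T \<Longrightarrow> \<bar>f t - f s\<bar> \<le> M"
  using f_bound[of s t] W_increment_powr_le(3)[of s t] M
  by (meson mult_left_le order_trans)

text \<open>Gives up part of the exponent \<open>1 / p\<close> in exchange for a power of the oscillation of \<open>f\<close>,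
  which is small on short intervals although \<open>W\<close> may jump.\<close>

lemma f_interpolate:
  assumes "0 \<le> s" "s \<le> u" "u \<le> t" "t \<le> T" "\<bar>f u - f s\<bar> \<le> \<eta>"
  shows "\<bar>f u - f s\<bar> \<le> \<eta> powr (1 - p / 2) * M powr (p / 2) * (W t - W s) powr (1 / 2)"
proof -
  let ?x = "\<bar>f u - f s\<bar>"
  have W: "0 \<le> W u - W s" "W u - W s \<le> W t - W s"
    using W_increment[of s u] W_increment[of u t] assms by auto
  have "?x = ?x powr (1 - p / 2) * ?x powr (p / 2)"
    using p by (cases "?x = 0") (auto simp flip: powr_add)
  also have "\<dots> \<le> \<eta> powr (1 - p / 2) * (M * (W t - W s) powr (1 / p)) powr (p / 2)"
  proof (intro mult_mono powr_mono2)
    have "?x \<le> M * (W u - W s) powr (1 / p)" using assms by (intro f_bound) auto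
    also have "\<dots> \<le> M * (W t - W s) powr (1 / p)"
      using W M p by (intro mult_left_mono powr_mono2) auto
    finally show "?x \<le> M * (W t - W s) powr (1 / p)" .
  qed (use assms p in auto)
  also have "\<dots> = \<eta> powr (1 - p / 2) * M powr (p / 2) * (W t - W s) powr (1 / 2)"
    using M p W by (simp add: powr_mult powr_powr)
  finally show ?thesis .
qed

lemma young_on_osc:
  assumes "0 \<le> a" "b \<le> T" "\<And>s t. a \<le> s \<Longrightarrow> s \<le> t \<Longrightarrow> t \<le> b \<Longrightarrow> \<bar>f t - f s\<bar> \<le> \<eta>"
  shows "young_on \<theta> (\<eta> powr (1 - p / 2) * M powr (p / 2) * L) W f g a b"
  unfolding young_on_def
proof (intro allI impI, elim conjE)
  fix s u v t assume st: "a \<le> s" "s \<le> u" "u \<le> t" "s \<le> v" "v \<le> t" "t \<le> b"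
  have W: "0 \<le> W t - W v" "W t - W v \<le> W t - W s"
    using W_increment[of s v] W_increment[of v t] st assms by auto
  have "\<bar>g t - g v\<bar> \<le> L * (W t - W v) powr (1 / p)"
    using st assms by (intro g_bound) auto
  also have "\<dots> \<le> L * (W t - W s) powr (1 / p)"
    using W L p by (intro mult_left_mono powr_mono2) auto
  finally have "\<bar>f u - f s\<bar> * \<bar>g t - g v\<bar> \<le> (\<eta> powr (1 - p / 2) * M powr (p / 2) * (W t - W s) powr (1 / 2))
     * (L * (W t - W s) powr (1 / p))"
    using st assms by (intro mult_mono f_interpolate) auto
  also have "\<dots> = \<eta> powr (1 - p / 2) * M powr (p / 2) * L * (W t - W s) powr \<theta>"
    by (simp add: \<theta>_def powr_add)
  finally show "\<bar>f u - f s\<bar> * \<bar>g t - g v\<bar>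
      \<le> \<eta> powr (1 - p / 2) * M powr (p / 2) * L * (W t - W s) powr \<theta>" .
qed

text \<open>As \<open>W\<close> grows by at most 1, \<open>M\<close> itself bounds the oscillation
  of \<open>f\<close>, and the two powers of \<open>M\<close> recombine to \<open>M\<close>.\<close>

lemma young_on_all: "young_on \<theta> (M * L) W f g 0 T"
proof -
  have "M powr (1 - p / 2) * M powr (p / 2) = M"
    using M p by (cases "M = 0") (auto simp flip: powr_add)
  then show ?thesis
    using young_on_osc[of 0 T M] f_le by simp
qed

text \<open>Uniform continuity of \<open>f\<close> makes the oscillation, and with it the factor,
  small on all short intervals at once, whatever \<open>W\<close> does there.\<close>

lemma young_on_small:
  assumes "0 < e"
  obtains \<delta> where "0 < \<delta>" "\<And>a b. 0 \<le> a \<Longrightarrow> b \<le> T \<Longrightarrow> b - a < \<delta> \<Longrightarrow> young_on \<theta> e W f g a b"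
proof -
  \<comment> \<open>Adding 1 keeps the divisor positive when \<open>M\<close> or \<open>L\<close>
    vanishes; \<eta> is chosen to solve \<eta> powr (1 - p/2) = e / c.\<close>
  define c where "c = M powr (p / 2) * L + 1"
  have c: "1 \<le> c" using L by (simp add: c_def)
  define \<eta> where "\<eta> = (e / c) powr (1 / (1 - p / 2))"
  have \<eta>: "0 < \<eta>" using assms c by (simp add: \<eta>_def)
  have "\<eta> powr (1 - p / 2) = e / c"
    using assms c p by (simp add: \<eta>_def powr_powr)
  then have "\<eta> powr (1 - p / 2) * M powr (p / 2) * L = e / c * (c - 1)"
    by (simp add: c_def)
  also have "\<dots> \<le> e" using assms c by (simp add: field_simps)
  finally have le: "\<eta> powr (1 - p / 2) * M powr (p / 2) * L \<le> e" .
  have "uniformly_continuous_on {0..T} f"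
    using f_cont by (intro compact_uniformly_continuous) auto
  then obtain \<delta> where \<delta>: "0 < \<delta>" "\<And>s t. s \<in> {0..T} \<Longrightarrow> t \<in> {0..T} \<Longrightarrow> \<bar>t - s\<bar> < \<delta> \<Longrightarrow> \<bar>f t - f s\<bar> < \<eta>"
    using \<eta> unfolding uniformly_continuous_on_def dist_real_def by metis
  show ?thesis
  proof (rule that[OF \<delta>(1)])
    fix a b assume ab: "0 \<le> a" "b \<le> T" "b - a < \<delta>"
    show "young_on \<theta> e W f g a b"
    proof (rule young_on_mono[OF young_on_osc le])
      fix s t assume "a \<le> s" "s \<le> t" "t \<le> b"
      then show "\<bar>f t - f s\<bar> \<le> \<eta>" using ab by (intro less_imp_le \<delta>) auto
    qed (use ab in auto)
  qed
qed

text \<open>On each cell [a,b] of level \<open>N\<close>, cut off at \<open>t\<close>, the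
  increments of both sums are close to f a * (g b - g a). As \<theta> > 1 and increments of
  \<open>W\<close> are at most 1, the errors are bounded by a small multiple of increments of
  \<open>W\<close>, which telescope.\<close>

lemma dyadic_sum_Cauchy:
  assumes t: "0 \<le> t" "t \<le> T"
  shows "Cauchy (\<lambda>n. dyadic_sum T f g n t)"
proof (rule metric_CauchyI)
  fix e :: real assume "0 < e"
  \<comment> \<open>Every level m \<ge> N will be within 2 * C * e' = e/4 of level \<open>N\<close>,
    hence any two within e/2.\<close>
  define e' where "e' = e / (8 * C)"
  have e': "0 < e'" using \<open>0 < e\<close> C by (simp add: e'_def)
  obtain \<delta> where \<delta>: "0 < \<delta>" "\<And>a b. 0 \<le> a \<Longrightarrow> b \<le> T \<Longrightarrow> b - a < \<delta> \<Longrightarrow> young_on \<theta> e' W f g a b"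
    using young_on_small[OF e'] by blast
  have "(\<lambda>n. T * (1/2)^n) \<longlonglongrightarrow> T * 0" by (intro tendsto_mult tendsto_const LIMSEQ_power_zero) auto
  then obtain N where "T * (1/2)^N < \<delta>"
    using order_tendstoD(2)[of _ "T * 0" sequentially \<delta>] \<delta>(1)
    by (auto simp: eventually_sequentially)
  then have N: "T / 2^N < \<delta>" by (simp add: power_divide)
  define r where "r i = T * real i / 2^N" for i
  have r: "0 \<le> r i" "r i \<le> r (Suc i)" "r (Suc i) - r i < \<delta>" for i
    using T N by (auto simp: r_def field_simps)
  have r_ends: "r 0 = 0" "r (2^N) = T" by (auto simp: r_def)
  have "\<bar>dyadic_sum T f g m t - dyadic_sum T f g N t\<bar> \<le> 2 * C * e'" if "N \<le> m" for m
  proof -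
    define D where "D z = dyadic_sum T f g m z - dyadic_sum T f g N z" for z
    let ?x = "\<lambda>i. min t (r i)"
    have telescope: "(\<Sum>i<2^N. h (?x (Suc i)) - h (?x i)) = h t - h 0" for h :: "real \<Rightarrow> real"
      using sum_lessThan_telescope[of "\<lambda>i. h (?x i)" "2^N"] t by (simp add: r_ends)
    have "\<bar>D (?x (Suc i)) - D (?x i)\<bar> \<le> 2 * C * e' * (W (?x (Suc i)) - W (?x i))" for i
    proof (cases "r i < t")
      case False
      then have "?x (Suc i) = t" "?x i = t" using r[of i] by auto
      then show ?thesis by simp
    next
      case True
      define a b where "a = r i" "b = ?x (Suc i)"
      have ab: "0 \<le> a" "a \<le> b" "b \<le> T" "b - a < \<delta>" "?x i = a"
        using r[of i] True t by (auto simp: a_b_def)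
      have Y: "young_on \<theta> e' W f g a b" using ab by (intro \<delta>) auto
      have "\<bar>dyadic_sum T f g n b - dyadic_sum T f g n a - f a * (g b - g a)\<bar>
          \<le> C * e' * (W b - W a) powr \<theta>" if "N \<le> n" for n
        by (rule dyadic_sum_young_grid[OF T \<theta>(1) _ W_mono ab(1-3) Y that])
           (use e' in \<open>auto simp: a_b_def r_def\<close>)
      from this[OF \<open>N \<le> m\<close>] this[OF order_refl]
      have "\<bar>D b - D a\<bar> \<le> 2 * (C * e' * (W b - W a) powr \<theta>)" unfolding D_def by linarith
      also have "\<dots> \<le> 2 * (C * e' * (W b - W a))"
        using C e' ab W_increment_powr_le(1)[of a b] by (intro mult_left_mono) auto
      finally show ?thesis using ab by (simp add: a_b_def)
    qed
    then have "\<bar>\<Sum>i<2^N. D (?x (Suc i)) - D (?x i)\<bar> \<le> (\<Sum>i<2^N. 2 * C * e' * (W (?x (Suc i)) - W (?x i)))"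
      by (intro order_trans[OF sum_abs] sum_mono)
    also have "\<dots> = 2 * C * e' * (W t - W 0)"
      unfolding sum_distrib_left[symmetric] telescope ..
    also have "\<dots> \<le> 2 * C * e' * 1" using W_increment[of 0 t] t C e' by (intro mult_left_mono) auto
    also have "(\<Sum>i<2^N. D (?x (Suc i)) - D (?x i)) = D t"
      unfolding telescope using T by (simp add: D_def dyadic_sum_zero)
    finally show ?thesis by (simp add: D_def)
  qed
  moreover have "2 * C * e' = e / 4" using C by (simp add: e'_def)
  ultimately have *: "\<bar>dyadic_sum T f g m t - dyadic_sum T f g N t\<bar> \<le> e / 4" if "N \<le> m" for m
    using that by simp
  show "\<exists>N. \<forall>m\<ge>N. \<forall>n\<ge>N. dist (dyadic_sum T f g m t) (dyadic_sum T f g n t) < e"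
  proof (intro exI allI impI)
    fix m n assume "N \<le> m" "N \<le> n"
    then show "dist (dyadic_sum T f g m t) (dyadic_sum T f g n t) < e"
      using *[of m] *[of n] \<open>0 < e\<close> unfolding dist_real_def by linarith
  qed
qed

section \<open>The limit of the dyadic sums and its estimates\<close>

definition young_integral :: "real \<Rightarrow> real" where "young_integral t = lim (\<lambda>n. dyadic_sum T f g n t)"

lemma dyadic_sum_tendsto: "0 \<le> t \<Longrightarrow> t \<le> T \<Longrightarrow> (\<lambda>n. dyadic_sum T f g n t) \<longlonglongrightarrow> young_integral t"
  unfolding young_integral_def using dyadic_sum_Cauchy convergent_LIMSEQ_iff Cauchy_convergent_iff by blast

lemma young_integral_zero: "young_integral 0 = 0"
  using T by (simp add: young_integral_def dyadic_sum_zero)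

text \<open>The error term of \<open>dyadic_sum_young\<close> vanishes in the limit: the grid points
  \<open>u n\<close> lie at most T / 2^n to the left of \<open>s\<close>, and \<open>f\<close> is
  continuous. A free \<open>A\<close> admits both the global factor of \<open>young_on_all\<close>
  and small local ones.\<close>

lemma young_integral_estimate:
  assumes st: "0 \<le> s" "s \<le> t" "t \<le> T" and "0 \<le> A" and Y: "young_on \<theta> A W f g s t"
  shows "\<bar>young_integral t - young_integral s - f s * (g t - g s)\<bar> \<le> C * A * (W t - W s) powr \<theta>"
proof -
  define u where "u n = T * real (nat \<lfloor>s * 2^n / T\<rfloor>) / 2^n" for n :: nat
  have u: "u n \<le> s" "s - T * (1/2)^n \<le> u n" for n
  proof -
    define k where "k = nat \<lfloor>s * 2^n / T\<rfloor>"
    have "real k \<le> s * 2^n / T" "s * 2^n / T < real k + 1"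
      using st T by (simp_all add: k_def)
    then have "T * real k \<le> s * 2^n" "s * 2^n \<le> T * real k + T"
      using T by (auto simp: field_simps)
    moreover from this have "s * 2^n / 2^n \<le> (T * real k + T) / 2^n"
      by (intro divide_right_mono) auto
    ultimately show "u n \<le> s" "s - T * (1/2)^n \<le> u n"
      unfolding u_def k_def[symmetric]
      by (auto simp: pos_divide_le_eq add_divide_distrib power_divide)
  qed
  have "0 \<le> u n" for n using T by (simp add: u_def)
  then have uT: "u n \<in> {0..T}" for n using u(1)[of n] st by auto
  have "(\<lambda>n. s - T * (1/2)^n) \<longlonglongrightarrow> s - T * 0"
    by (intro tendsto_intros LIMSEQ_power_zero) auto
  then have "u \<longlonglongrightarrow> s"
    using u by (intro tendsto_sandwich[of "\<lambda>n. s - T * (1/2)^n" u _ "\<lambda>_. s"]) (auto simp: always_eventually)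
  then have fu: "(\<lambda>n. f (u n)) \<longlonglongrightarrow> f s"
    using st uT by (intro continuous_on_tendsto_compose[OF f_cont]) (auto intro: always_eventually)
  have "\<bar>dyadic_sum T f g n t - dyadic_sum T f g n s - f s * (g t - g s)\<bar>
      \<le> C * A * (W t - W s) powr \<theta> + \<bar>f (u n) - f s\<bar> * L" for n
  proof -
    obtain v where v: "s \<le> v" "v \<le> t" and
      "\<bar>dyadic_sum T f g n t - dyadic_sum T f g n s - f s * (g t - g s)\<bar>
        \<le> C * A * (W t - W s) powr \<theta> + \<bar>f (u n) - f s\<bar> * \<bar>g v - g s\<bar>"
      using dyadic_sum_young[OF T \<theta>(1) \<open>0 \<le> A\<close> W_mono st Y, of n] unfolding u_def by blast
    note this(3)
    also have "\<bar>f (u n) - f s\<bar> * \<bar>g v - g s\<bar> \<le> \<bar>f (u n) - f s\<bar> * L"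
      using st v by (intro mult_left_mono g_le) auto
    finally show ?thesis by simp
  qed
  moreover have "(\<lambda>n. \<bar>dyadic_sum T f g n t - dyadic_sum T f g n s - f s * (g t - g s)\<bar>)
      \<longlonglongrightarrow> \<bar>young_integral t - young_integral s - f s * (g t - g s)\<bar>"
    using st by (intro tendsto_intros dyadic_sum_tendsto) auto
  moreover have "(\<lambda>n. C * A * (W t - W s) powr \<theta> + \<bar>f (u n) - f s\<bar> * L)
     \<longlonglongrightarrow> C * A * (W t - W s) powr \<theta> + \<bar>f s - f s\<bar> * L"
    by (intro tendsto_add tendsto_mult tendsto_rabs tendsto_diff fu tendsto_const)
  ultimately have "\<bar>young_integral t - young_integral s - f s * (g t - g s)\<bar>
      \<le> C * A * (W t - W s) powr \<theta> + \<bar>f s - f s\<bar> * L"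
    by (intro LIMSEQ_le) auto
  then show ?thesis by simp
qed

text \<open>Compared with the left-point approximation, an arbitrary tag costs one more product of
  increments, whence 1 + C in place of C. Increments of \<open>W\<close> telescope over any
  division.\<close>

lemma has_rs_integral_young_integral:
  assumes t: "0 \<le> t" "t \<le> T"
  shows "has_rs_integral f g 0 t (young_integral t)"
  unfolding has_rs_integral_def
proof (intro allI impI)
  fix e :: real assume "0 < e"
  define e' where "e' = e / (2 * (1 + C))"
  have "1 + C \<noteq> 0" using C by simp
  then have e': "0 < e'" "(1 + C) * e' = e / 2"
    using \<open>0 < e\<close> C unfolding e'_def by (auto simp del: distrib_left_numeral)
  obtain \<delta> where \<delta>: "0 < \<delta>" "\<And>a b. 0 \<le> a \<Longrightarrow> b \<le> T \<Longrightarrow> b - a < \<delta> \<Longrightarrow> young_on \<theta> e' W f g a b"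
    using young_on_small[OF e'(1)] by blast
  show "\<exists>\<delta>>0. \<forall>D. D tagged_division_of {0..t} \<and> (\<forall>(\<xi>, K)\<in>D. Sup K - Inf K < \<delta>) \<longrightarrow>
     \<bar>(\<Sum>(\<xi>, K)\<in>D. f \<xi> * (g (Sup K) - g (Inf K))) - young_integral t\<bar> < e"
  proof (intro exI[of _ \<delta>] conjI \<delta>(1) allI impI, elim conjE)
    fix D assume D: "D tagged_division_of {0..t}" "\<forall>(\<xi>, K)\<in>D. Sup K - Inf K < \<delta>"
    have "\<bar>f \<xi> * (g (Sup K) - g (Inf K)) - (young_integral (Sup K) - young_integral (Inf K))\<bar>
        \<le> (1 + C) * e' * (W (Sup K) - W (Inf K))"
      if \<xi>K: "(\<xi>, K) \<in> D" for \<xi> K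
    proof -
      obtain a b where K: "K = {a..b}" using tagged_division_ofD(4)[OF D(1) \<xi>K] by auto
      have \<xi>: "a \<le> \<xi>" "\<xi> \<le> b" "0 \<le> a" "b \<le> t"
        using tagged_division_ofD(2,3)[OF D(1) \<xi>K] unfolding K by auto
      then have S: "Sup K = b" "Inf K = a" by (auto simp: K)
      have "b - a < \<delta>" using D(2) \<xi>K S by fastforce
      then have Y: "young_on \<theta> e' W f g a b" using \<xi> t by (intro \<delta>) auto
      have "\<bar>young_integral b - young_integral a - f a * (g b - g a)\<bar> \<le> C * e' * (W b - W a) powr \<theta>"
        using \<xi> t e' by (intro young_integral_estimate Y) auto
      moreover have "\<bar>(f \<xi> - f a) * (g b - g a)\<bar> \<le> e' * (W b - W a) powr \<theta>"
        unfolding abs_mult using Y \<xi> unfolding young_on_def by force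
      moreover have "f \<xi> * (g b - g a) - (young_integral b - young_integral a)
          = (f \<xi> - f a) * (g b - g a) - (young_integral b - young_integral a - f a * (g b - g a))"
        by (simp add: algebra_simps)
      ultimately have "\<bar>f \<xi> * (g b - g a) - (young_integral b - young_integral a)\<bar>
          \<le> (1 + C) * e' * (W b - W a) powr \<theta>"
        unfolding distrib_right by linarith
      also have "\<dots> \<le> (1 + C) * e' * (W b - W a)"
        using \<xi> t e' C by (intro mult_left_mono W_increment_powr_le) auto
      finally show ?thesis by (simp add: S)
    qed
    then have "\<bar>\<Sum>(\<xi>, K)\<in>D. f \<xi> * (g (Sup K) - g (Inf K))
        - (young_integral (Sup K) - young_integral (Inf K))\<bar>
        \<le> (\<Sum>(\<xi>, K)\<in>D. (1 + C) * e' * (W (Sup K) - W (Inf K)))"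
      by (intro order_trans[OF sum_abs] sum_mono) auto
    also have "\<dots> = (1 + C) * e' * (W t - W 0)"
      unfolding additive_tagged_division_1[OF t(1) D(1), of W, symmetric] sum_distrib_left
      by (simp add: case_prod_beta)
    also have "\<dots> \<le> (1 + C) * e' * 1"
      using W_increment[of 0 t] t C e' by (intro mult_left_mono) auto
    also have "(\<Sum>(\<xi>, K)\<in>D. f \<xi> * (g (Sup K) - g (Inf K))
        - (young_integral (Sup K) - young_integral (Inf K))) =
       (\<Sum>(\<xi>, K)\<in>D. f \<xi> * (g (Sup K) - g (Inf K))) - young_integral t"
      using additive_tagged_division_1[OF t(1) D(1), of young_integral]
      by (simp add: case_prod_beta sum_subtractf young_integral_zero)
    finally show "\<bar>(\<Sum>(\<xi>, K)\<in>D. f \<xi> * (g (Sup K) - g (Inf K))) - young_integral t\<bar> < e"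
      using e' \<open>0 < e\<close> by simp
  qed
qed

text \<open>Increments do not see constants, yet a constant \<open>f\<close> integrates to a
  multiple of the increment of \<open>g\<close>; hence the bound on \<open>f 0\<close>. The
  left-point term gives 2 * M * L and the Young error C * M * L.\<close>

lemma young_integral_bound:
  assumes st: "0 \<le> s" "s \<le> t" "t \<le> T" and "\<bar>f 0\<bar> \<le> M"
  shows "\<bar>young_integral t - young_integral s\<bar> \<le> (2 + C) * M * L * (W t - W s) powr (1 / p)"
proof -
  have "\<bar>f s\<bar> \<le> 2 * M" using f_le[of 0 s] assms by linarith
  then have "\<bar>f s * (g t - g s)\<bar> \<le> (2 * M) * (L * (W t - W s) powr (1 / p))"
    unfolding abs_mult using st M by (intro mult_mono g_bound) auto
  moreover have "\<bar>young_integral t - young_integral s - f s * (g t - g s)\<bar> \<le> C * (M * L) * (W t - W s) powr \<theta>"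
    using st M L young_on_subset[OF young_on_all] by (intro young_integral_estimate) auto
  moreover have "C * (M * L) * (W t - W s) powr \<theta> \<le> C * (M * L) * (W t - W s) powr (1 / p)"
    using st M L C by (intro mult_left_mono W_increment_powr_le) auto
  ultimately show ?thesis unfolding distrib_right by linarith
qed

text \<open>\<open>young_integral_bound\<close> does not yield continuity, as \<open>W\<close> may
  jump. Continuity of \<open>g\<close> handles the left-point term, the small factor of
  \<open>young_on_small\<close> the rest.\<close>

lemma young_integral_continuous: "continuous_on {0..T} young_integral"
  unfolding continuous_on_iff
proof (intro ballI allI impI)
  fix x e :: real assume x: "x \<in> {0..T}" and "0 < e"
  define e' where "e' = e / (4 * C)"
  have e': "0 < e'" "C * e' = e / 4" using \<open>0 < e\<close> C by (simp_all add: e'_def)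
  define B where "B = \<bar>f 0\<bar> + M + 1"
  have B: "0 < B" using M by (simp add: B_def)
  obtain \<delta> where \<delta>: "0 < \<delta>" "\<And>a b. 0 \<le> a \<Longrightarrow> b \<le> T \<Longrightarrow> b - a < \<delta> \<Longrightarrow> young_on \<theta> e' W f g a b"
    using young_on_small[OF e'(1)] by blast
  have "uniformly_continuous_on {0..T} g"
    using g_cont by (intro compact_uniformly_continuous) auto
  moreover have "0 < e / (2 * B)" using \<open>0 < e\<close> B by simp
  ultimately obtain \<delta>' where \<delta>': "0 < \<delta>'"
    "\<And>s t. s \<in> {0..T} \<Longrightarrow> t \<in> {0..T} \<Longrightarrow> \<bar>t - s\<bar> < \<delta>' \<Longrightarrow> \<bar>g t - g s\<bar> < e / (2 * B)"
    unfolding uniformly_continuous_on_def dist_real_def by metis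
  have *: "\<bar>young_integral b - young_integral a\<bar> < e"
    if ab: "0 \<le> a" "a \<le> b" "b \<le> T" "b - a < min \<delta> \<delta>'" for a b
  proof -
    have "\<bar>young_integral b - young_integral a - f a * (g b - g a)\<bar> \<le> C * e' * (W b - W a) powr \<theta>"
      using ab e' by (intro young_integral_estimate \<delta>) auto
    also have "\<dots> \<le> C * e' * 1"
      using C e' W_increment_powr_le(2,3)[of a b] ab by (intro mult_left_mono) auto
    finally have 1: "\<bar>young_integral b - young_integral a - f a * (g b - g a)\<bar> \<le> e / 4" using e' by simp
    have "\<bar>f a\<bar> \<le> B" using f_le[of 0 a] ab by (auto simp: B_def)
    then have "\<bar>f a * (g b - g a)\<bar> \<le> B * (e / (2 * B))"
      unfolding abs_mult using ab B by (intro mult_mono less_imp_le[OF \<delta>'(2)]) auto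
    then have "\<bar>f a * (g b - g a)\<bar> \<le> e / 2" using B by simp
    with 1 show ?thesis using \<open>0 < e\<close> by linarith
  qed
  show "\<exists>d>0. \<forall>x'\<in>{0..T}. dist x' x < d \<longrightarrow> dist (young_integral x') (young_integral x) < e"
  proof (intro exI[of _ "min \<delta> \<delta>'"] conjI ballI impI)
    fix y assume "y \<in> {0..T}" "dist y x < min \<delta> \<delta>'"
    then show "dist (young_integral y) (young_integral x) < e"
      using *[of x y] *[of y x] x
      by (cases "x \<le> y") (auto simp: dist_real_def abs_minus_commute)
  qed (use \<delta> \<delta>' in auto)
qed

end

section \<open>Uniqueness and additivity of Riemann-Stieltjes integrals\<close>

lemma has_rs_integral_unique:
  assumes "a \<le> b" "has_rs_integral f g a b I" "has_rs_integral f g a b I'"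
  shows "I = I'"
proof (rule ccontr)
  assume "I \<noteq> I'"
  then have e: "0 < \<bar>I - I'\<bar> / 2" by simp
  obtain \<delta> where \<delta>: "0 < \<delta>" "\<And>D. D tagged_division_of {a..b} \<Longrightarrow> \<forall>(\<xi>, K)\<in>D. Sup K - Inf K < \<delta> \<Longrightarrow>
      \<bar>(\<Sum>(\<xi>, K)\<in>D. f \<xi> * (g (Sup K) - g (Inf K))) - I\<bar> < \<bar>I - I'\<bar> / 2"
    using assms(2) e unfolding has_rs_integral_def by meson
  obtain \<delta>' where \<delta>': "0 < \<delta>'" "\<And>D. D tagged_division_of {a..b} \<Longrightarrow> \<forall>(\<xi>, K)\<in>D. Sup K - Inf K < \<delta>' \<Longrightarrow>
      \<bar>(\<Sum>(\<xi>, K)\<in>D. f \<xi> * (g (Sup K) - g (Inf K))) - I'\<bar> < \<bar>I - I'\<bar> / 2"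
    using assms(3) e unfolding has_rs_integral_def by meson
  \<comment> \<open>Two limits can be compared only if some division is finer than both meshes.
    Cousin's lemma for balls of constant radius \<open>d\<close> gives one, with cells shorter than
    2 * d.\<close>
  define d where "d = min \<delta> \<delta>' / 2"
  have d: "0 < d" "2 * d \<le> \<delta>" "2 * d \<le> \<delta>'" using \<delta>(1) \<delta>'(1) by (auto simp: d_def)
  obtain D where D: "D tagged_division_of {a..b}" "(\<lambda>x. ball x d) fine D"
    using fine_division_exists_real[OF gauge_ball[OF d(1)]] by blast
  have "Sup K - Inf K < 2 * d" if \<xi>K: "(\<xi>, K) \<in> D" for \<xi> K
  proof -
    obtain u v where K: "K = {u..v}" using tagged_division_ofD(4)[OF D(1) \<xi>K] by auto
    have "\<xi> \<in> K" using tagged_division_ofD(2)[OF D(1) \<xi>K] .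
    moreover have "K \<subseteq> ball \<xi> d" using fineD[OF D(2) \<xi>K] .
    ultimately have "u \<le> v" "u \<in> ball \<xi> d" "v \<in> ball \<xi> d"
      unfolding K by (auto simp del: mem_ball)
    then show ?thesis by (auto simp: K dist_real_def)
  qed
  then have "\<forall>(\<xi>, K)\<in>D. Sup K - Inf K < \<delta>" "\<forall>(\<xi>, K)\<in>D. Sup K - Inf K < \<delta>'"
    using d by fastforce+
  from \<delta>(2)[OF D(1) this(1)] \<delta>'(2)[OF D(1) this(2)]
  show False by (smt (verit) field_sum_of_halves)
qed

lemma rs_integral_eq:
  "a \<le> b \<Longrightarrow> has_rs_integral f g a b I \<Longrightarrow> rs_integral f g a b = I"
  unfolding rs_integral_def by (intro the_equality) (auto intro: has_rs_integral_unique)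

text \<open>The hypothesis is an identity between single terms of the sums, so it covers splitting
  the integrand and splitting the integrator alike.\<close>

lemma has_rs_integral_add:
  assumes "has_rs_integral f1 g1 a b I1" "has_rs_integral f2 g2 a b I2"
    and "\<And>\<xi> s t. f \<xi> * (g t - g s) = f1 \<xi> * (g1 t - g1 s) + f2 \<xi> * (g2 t - g2 s)"
  shows "has_rs_integral f g a b (I1 + I2)"
  unfolding has_rs_integral_def
proof (intro allI impI)
  fix e :: real assume "0 < e"
  then have e: "0 < e / 2" by simp
  obtain \<delta> where \<delta>: "0 < \<delta>" "\<And>D. D tagged_division_of {a..b} \<Longrightarrow> \<forall>(\<xi>, K)\<in>D. Sup K - Inf K < \<delta> \<Longrightarrow>
      \<bar>(\<Sum>(\<xi>, K)\<in>D. f1 \<xi> * (g1 (Sup K) - g1 (Inf K))) - I1\<bar> < e / 2"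
    using assms(1) e unfolding has_rs_integral_def by meson
  obtain \<delta>' where \<delta>': "0 < \<delta>'" "\<And>D. D tagged_division_of {a..b} \<Longrightarrow> \<forall>(\<xi>, K)\<in>D. Sup K - Inf K < \<delta>' \<Longrightarrow>
      \<bar>(\<Sum>(\<xi>, K)\<in>D. f2 \<xi> * (g2 (Sup K) - g2 (Inf K))) - I2\<bar> < e / 2"
    using assms(2) e unfolding has_rs_integral_def by meson
  have pos: "0 < min \<delta> \<delta>'" using \<delta>(1) \<delta>'(1) by simp
  show "\<exists>\<delta>>0. \<forall>D. D tagged_division_of {a..b} \<and> (\<forall>(\<xi>, K)\<in>D. Sup K - Inf K < \<delta>) \<longrightarrow>
      \<bar>(\<Sum>(\<xi>, K)\<in>D. f \<xi> * (g (Sup K) - g (Inf K))) - (I1 + I2)\<bar> < e"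
  proof (intro exI[of _ "min \<delta> \<delta>'"] conjI[OF pos] allI impI, elim conjE)
    fix D assume D: "D tagged_division_of {a..b}" "\<forall>(\<xi>, K)\<in>D. Sup K - Inf K < min \<delta> \<delta>'"
    then have "\<forall>(\<xi>, K)\<in>D. Sup K - Inf K < \<delta>" "\<forall>(\<xi>, K)\<in>D. Sup K - Inf K < \<delta>'" by fastforce+
    with D \<delta>(2) \<delta>'(2)
    have "\<bar>(\<Sum>(\<xi>, K)\<in>D. f1 \<xi> * (g1 (Sup K) - g1 (Inf K))) - I1\<bar> < e / 2"
      "\<bar>(\<Sum>(\<xi>, K)\<in>D. f2 \<xi> * (g2 (Sup K) - g2 (Inf K))) - I2\<bar> < e / 2" by blast+
    then show "\<bar>(\<Sum>(\<xi>, K)\<in>D. f \<xi> * (g (Sup K) - g (Inf K))) - (I1 + I2)\<bar> < e"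
      unfolding assms(3) case_prod_beta sum.distrib by linarith
  qed
qed

lemma rs_integral_refl: "rs_integral f g a a = 0"
proof (rule rs_integral_eq)
  have "(\<Sum>(\<xi>, K)\<in>D. f \<xi> * (g (Sup K) - g (Inf K))) = 0" if D: "D tagged_division_of {a..a}" for D
  proof (intro sum.neutral ballI, clarify)
    fix \<xi> K assume "(\<xi>, K) \<in> D"
    then have "K = {a}" using tagged_division_ofD(2,3)[OF D] by fastforce
    then show "f \<xi> * (g (Sup K) - g (Inf K)) = 0" by simp
  qed
  then show "has_rs_integral f g a a 0"
    unfolding has_rs_integral_def by (auto intro: exI[of _ 1])
qed simp

section \<open>Integration as a bounded bilinear map in p-variation\<close>

text \<open>A superadditive control \<open>\<omega>(s,t)\<close>, such as the \<open>p\<close>-th power of the \<open>p\<close>-variation, is at most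
  \<open>\<omega>(0,t) - \<omega>(0,s)\<close>, so that the increments of a monotone function suffice as controls. The
  infimum of all admissible \<open>M\<close> is the \<open>p\<close>-variation norm.\<close>

definition p_controlled :: "real \<Rightarrow> real \<Rightarrow> real \<Rightarrow> (real \<Rightarrow> real) \<Rightarrow> bool" where
  "p_controlled p T M f \<longleftrightarrow> continuous_on {0..T} f \<and>
     (\<exists>W. mono_on {0..T} W \<and> W T - W 0 \<le> 1 \<and>
       (\<forall>s t. 0 \<le> s \<and> s \<le> t \<and> t \<le> T \<longrightarrow> \<bar>f t - f s\<bar> \<le> M * (W t - W s) powr (1 / p)))"

lemma p_controlled_cong:
  assumes "p_controlled p T M f" "\<And>t. 0 \<le> t \<Longrightarrow> t \<le> T \<Longrightarrow> f t = h t"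
  shows "p_controlled p T M h"
proof -
  have "continuous_on {0..T} f \<longleftrightarrow> continuous_on {0..T} h"
    using assms(2) by (intro continuous_on_cong) auto
  moreover have "f t - f s = h t - h s" if "0 \<le> s" "s \<le> t" "t \<le> T" for s t
    using assms(2)[of s] assms(2)[of t] that by auto
  ultimately show ?thesis
    using assms(1) unfolding p_controlled_def by (metis (no_types, lifting))
qed

lemma p_controlled_mono:
  assumes "p_controlled p T M f" "M \<le> L"
  shows "p_controlled p T L f"
proof -
  have "M * (w::real) powr q \<le> L * w powr q" for w q
    using assms(2) by (intro mult_right_mono) auto
  then show ?thesis
    using assms(1) unfolding p_controlled_def by (meson order_trans)
qed

text \<open>The two controls are averaged; the factor 2 bounds \<open>2 powr (1 / p)\<close>.\<close>

lemma common_control: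
  assumes "1 \<le> p" "p < 2" "0 < T" "0 \<le> M" "0 \<le> L"
    and "p_controlled p T M f" "p_controlled p T L g"
  obtains W where "young_pair p T (2 * M) (2 * L) f g W"
proof -
  obtain W where W: "mono_on {0..T} W" "W T - W 0 \<le> 1"
    "\<And>s t. 0 \<le> s \<Longrightarrow> s \<le> t \<Longrightarrow> t \<le> T \<Longrightarrow> \<bar>f t - f s\<bar> \<le> M * (W t - W s) powr (1 / p)"
    using assms(6) unfolding p_controlled_def by blast
  obtain W' where W': "mono_on {0..T} W'" "W' T - W' 0 \<le> 1"
    "\<And>s t. 0 \<le> s \<Longrightarrow> s \<le> t \<Longrightarrow> t \<le> T \<Longrightarrow> \<bar>g t - g s\<bar> \<le> L * (W' t - W' s) powr (1 / p)"
    using assms(7) unfolding p_controlled_def by blast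
  define V where "V t = (W t + W' t) / 2" for t
  have root: "w powr (1 / p) \<le> 2 * v powr (1 / p)" if "0 \<le> w" "w \<le> 2 * v" for v w
  proof -
    have "w powr (1 / p) \<le> (2 * v) powr (1 / p)"
      using that assms(1) by (intro powr_mono2) auto
    also have "\<dots> = 2 powr (1 / p) * v powr (1 / p)"
      using that by (simp add: powr_mult)
    also have "\<dots> \<le> 2 powr 1 * v powr (1 / p)"
      using assms(1) by (intro mult_right_mono powr_mono) auto
    finally show ?thesis by simp
  qed
  have mono: "W s \<le> W t" "W' s \<le> W' t" if "0 \<le> s" "s \<le> t" "t \<le> T" for s t
    using that by (auto intro!: mono_onD[OF W(1)] mono_onD[OF W'(1)])
  have "young_pair p T (2 * M) (2 * L) f g V"
  proof
    show "mono_on {0..T} V" "V T - V 0 \<le> 1"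
      using W(2) W'(2) mono by (auto simp: V_def field_simps intro!: mono_onI add_mono)
    fix s t assume st: "0 \<le> s" "s \<le> t" "t \<le> T"
    have "(W t - W s) powr (1 / p) \<le> 2 * (V t - V s) powr (1 / p)"
      "(W' t - W' s) powr (1 / p) \<le> 2 * (V t - V s) powr (1 / p)"
      using mono[OF st] by (auto intro!: root simp: V_def field_simps)
    from this[THEN mult_left_mono, OF assms(4)] this[THEN mult_left_mono, OF assms(5)]
    show "\<bar>f t - f s\<bar> \<le> 2 * M * (V t - V s) powr (1 / p)"
      "\<bar>g t - g s\<bar> \<le> 2 * L * (V t - V s) powr (1 / p)"
      using W(3)[OF st] W'(3)[OF st] by simp_all
  qed (use assms in \<open>auto simp: p_controlled_def\<close>)
  then show ?thesis by (rule that)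
qed

lemma p_controlled_add:
  assumes "1 \<le> p" "p < 2" "0 < T" "0 \<le> M" "0 \<le> L"
    and "p_controlled p T M f" "p_controlled p T L g"
  shows "p_controlled p T (2 * (M + L)) (\<lambda>t. f t + g t)"
proof -
  obtain W where "young_pair p T (2 * M) (2 * L) f g W"
    using common_control[OF assms] .
  then interpret young_pair p T "2 * M" "2 * L" f g W .
  have "\<bar>f t + g t - (f s + g s)\<bar> \<le> 2 * (M + L) * (W t - W s) powr (1 / p)"
    if "0 \<le> s" "s \<le> t" "t \<le> T" for s t
    using f_bound[OF that] g_bound[OF that] by (simp add: algebra_simps)
  then show ?thesis
    unfolding p_controlled_def using f_cont g_cont W_mono W_le by (auto intro!: continuous_on_add)
qed

text \<open>The factor 2 + C of \<open>young_integral_bound\<close>, times 4 since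
  \<open>common_control\<close> doubles both \<open>M\<close> and \<open>L\<close>.\<close>

definition integral_const :: "real \<Rightarrow> real" where
  "integral_const p = 4 * (2 + young_const (1 / p + 1 / 2))"

lemma
  assumes "1 \<le> p" "p < 2" "0 < T" "0 \<le> M" "0 \<le> L"
    and "p_controlled p T M f" "p_controlled p T L g"
  shows has_rs_integral_controlled:
      "0 \<le> t \<Longrightarrow> t \<le> T \<Longrightarrow> has_rs_integral f g 0 t (rs_integral f g 0 t)"
    and p_controlled_rs_integral:
      "\<bar>f 0\<bar> \<le> M \<Longrightarrow> p_controlled p T (integral_const p * M * L) (\<lambda>t. rs_integral f g 0 t)"
proof -
  obtain W where "young_pair p T (2 * M) (2 * L) f g W"
    using common_control[OF assms] .
  then interpret young_pair p T "2 * M" "2 * L" f g W .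
  have eq: "rs_integral f g 0 t = young_integral t" if "0 \<le> t" "t \<le> T" for t
    using that has_rs_integral_young_integral by (intro rs_integral_eq)
  then show "0 \<le> t \<Longrightarrow> t \<le> T \<Longrightarrow> has_rs_integral f g 0 t (rs_integral f g 0 t)"
    using has_rs_integral_young_integral by simp
  assume "\<bar>f 0\<bar> \<le> M"
  then have f0: "\<bar>f 0\<bar> \<le> 2 * M" by simp
  have "integral_const p * M * L = (2 + C) * (2 * M) * (2 * L)"
    by (simp add: integral_const_def \<theta>_def)
  then have "p_controlled p T (integral_const p * M * L) young_integral"
    unfolding p_controlled_def using young_integral_continuous W_mono W_le young_integral_bound[OF _ _ _ f0] by metis
  then show "p_controlled p T (integral_const p * M * L) (\<lambda>t. rs_integral f g 0 t)"
    by (rule p_controlled_cong) (simp add: eq)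
qed

section \<open>From finite p-variation to a monotone control\<close>

lemma p_controlled_of_pvar:
  fixes X :: "real \<Rightarrow> real ^ 'd::finite"
  assumes "1 \<le> p" "0 < T" "0 < M" "continuous_on {0..T} X" "pvar p T X \<le> ennreal M"
  shows "p_controlled p T M (\<lambda>t. X t $ i)"
proof -
  define V where "V P = (\<Sum>K\<in>P. norm (X (Sup K) - X (Inf K)) powr p)" for P
  define S where "S = (SUP P \<in> {P. P division_of {0..T}}. ennreal (V P))"
  have pvar: "pvar p T X = (if S = top then top else ennreal (enn2real S powr (1 / p)))"
    by (simp add: pvar_def S_def V_def Let_def)
  then have S: "S \<noteq> top" "enn2real S powr (1 / p) \<le> M"
    using assms(3,5) by (auto split: if_splits simp: top_unique)
  then have "(enn2real S powr (1 / p)) powr p \<le> M powr p"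
    using assms(1) by (intro powr_mono2) auto
  then have SM: "enn2real S \<le> M powr p"
    using assms(1) by (simp add: powr_powr)
  have V_le_T: "V P \<le> M powr p" if "P division_of {0..T}" for P
  proof -
    have "ennreal (V P) \<le> S" unfolding S_def using that by (intro SUP_upper) simp
    then have "ennreal (V P) \<le> ennreal (enn2real S)" using S by (simp add: less_top)
    then have "V P \<le> enn2real S" by (subst (asm) ennreal_le_iff) auto
    then show ?thesis using SM by simp
  qed
  have extend: "insert {s..t} P division_of {0..t}" "V (insert {s..t} P) = V P + norm (X t - X s) powr p"
    if "P division_of {0..s}" "0 \<le> s" "s \<le> t" for P s t
  proof -
    have "(P \<union> {{s..t}}) division_of {0..s} \<union> {s..t}"
      using that division_of_self[of s t]
      by (intro division_disjoint_union) (auto simp: interior_atLeastAtMost_real)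
    moreover have "{0..s} \<union> {s..t} = {0..t}" using that by auto
    ultimately show "insert {s..t} P division_of {0..t}" by simp
    show "V (insert {s..t} P) = V P + norm (X t - X s) powr p"
    \<comment> \<open>An interval [s,t] already in \<open>P\<close> lies in [0,s], so it is the
      single point \<open>s\<close> and contributes 0; inserting it again loses nothing.\<close>
    proof (cases "{s..t} \<in> P")
      case True
      then have "t = s" using division_ofD(2)[OF that(1) True] that by auto
      then show ?thesis using True by (simp add: insert_absorb)
    next
      case False
      then show ?thesis using division_of_finite[OF that(1)] that(3) by (simp add: V_def)
    qed
  qed
  have V_le: "V P \<le> M powr p" if "P division_of {0..t}" "0 \<le> t" "t \<le> T" for P t
  proof -
    have "V P \<le> V (insert {t..T} P)" using extend(2)[OF that] by simp
    also have "\<dots> \<le> M powr p" using extend(1)[OF that] by (rule V_le_T)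
    finally show ?thesis .
  qed
  \<comment> \<open>\<open>Q t\<close> is the p-th power of the p-variation on [0,t]. Appending
    [s,t] to divisions of [0,s] shows that its increments dominate those of the path; dividing by M
    powr p normalises it.\<close>
  define Q where "Q t = (SUP P\<in>{P. P division_of {0..t}}. V P)" for t
  have bdd: "bdd_above (V ` {P. P division_of {0..t}})" if "0 \<le> t" "t \<le> T" for t
    using V_le that by (intro bdd_aboveI2) auto
  have nonempty: "{P. P division_of {0..t}} \<noteq> {}" for t :: real
    using elementary_interval[of 0 t] by auto
  have Q: "Q s + norm (X t - X s) powr p \<le> Q t" if st: "0 \<le> s" "s \<le> t" "t \<le> T" for s t
  proof -
    have "Q s \<le> Q t - norm (X t - X s) powr p"
      unfolding Q_def[of s]
    proof (rule cSUP_least[OF nonempty])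
      fix P assume "P \<in> {P. P division_of {0..s}}"
      then have P: "P division_of {0..s}" by simp
      have "V (insert {s..t} P) \<le> Q t"
        unfolding Q_def using st extend(1)[OF P] by (intro cSUP_upper bdd) auto
      then show "V P \<le> Q t - norm (X t - X s) powr p"
        using extend(2)[OF P] st by simp
    qed
    then show ?thesis by simp
  qed
  have Q_mono: "Q s \<le> Q t" if "0 \<le> s" "s \<le> t" "t \<le> T" for s t
    using Q[OF that] powr_ge_zero[of "norm (X t - X s)" p] by linarith
  have "Q T \<le> M powr p"
    unfolding Q_def by (rule cSUP_least[OF nonempty]) (auto intro: V_le_T)
  moreover obtain P0 :: "real set set" where P0: "P0 division_of {0..0}" using nonempty[of 0] by blast
  then have "0 \<le> V P0" unfolding V_def by (intro sum_nonneg) auto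
  then have "0 \<le> Q 0"
    using P0 assms(2) bdd[of 0] unfolding Q_def by (intro cSUP_upper2[where x = P0]) auto
  ultimately have QT: "Q T - Q 0 \<le> M powr p" by linarith
  define W where "W t = Q t / M powr p" for t
  have W_diff: "W t - W s = (Q t - Q s) / M powr p" for s t
    by (simp add: W_def diff_divide_distrib)
  have Mp: "0 < M powr p" using assms(3) by simp
  have "\<bar>X t $ i - X s $ i\<bar> \<le> M * (W t - W s) powr (1 / p)" if st: "0 \<le> s" "s \<le> t" "t \<le> T" for s t
  proof -
    have W_nonneg: "0 \<le> W t - W s" using Q_mono[OF st] Mp by (simp add: W_diff)
    have "\<bar>X t $ i - X s $ i\<bar> \<le> norm (X t - X s)"
      using component_le_norm_cart[of "X t - X s" i] by simp
    also have "\<dots> = (norm (X t - X s) powr p) powr (1 / p)"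
      using assms(1) by (simp add: powr_powr)
    also have "\<dots> \<le> (Q t - Q s) powr (1 / p)"
      using Q[OF st] assms(1) by (intro powr_mono2) auto
    also have "\<dots> = (M powr p * (W t - W s)) powr (1 / p)"
      using Mp by (simp add: W_diff)
    also have "\<dots> = M * (W t - W s) powr (1 / p)"
      using assms(1,3) W_nonneg by (simp add: powr_mult powr_powr)
    finally show ?thesis .
  qed
  moreover have "mono_on {0..T} W"
    using Q_mono Mp by (intro mono_onI) (auto simp: W_def divide_right_mono)
  moreover have "W T - W 0 \<le> 1" unfolding W_diff using QT Mp by (simp add: pos_divide_le_eq)
  moreover have "continuous_on {0..T} (\<lambda>t. X t $ i)"
    using assms(4) by (intro continuous_intros)
  ultimately show ?thesis unfolding p_controlled_def by blast
qed

section \<open>Continuity of the signature\<close>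

text \<open>Only increments are compared, so starting values are treated apart. \<epsilon> is any
  null sequence of admissible bounds, since constants grow with each integration. The bounds hold
  eventually, as an \<open>ennreal\<close> sequence tending to 0 is known to be finite only from
  some index on.\<close>

definition p_converges :: "real \<Rightarrow> real \<Rightarrow> (nat \<Rightarrow> real \<Rightarrow> real) \<Rightarrow> (real \<Rightarrow> real) \<Rightarrow> bool" where
  "p_converges p T fn f \<longleftrightarrow> (\<exists>M \<epsilon>. 0 \<le> M \<and> (\<forall>n. 0 \<le> \<epsilon> n) \<and> \<epsilon> \<longlonglongrightarrow> 0 \<and> p_controlled p T M f \<and>
     (\<forall>\<^sub>F n in sequentially. p_controlled p T (\<epsilon> n) (\<lambda>t. fn n t - f t)))"

lemma p_converges_const: "p_converges p T (\<lambda>_ _. c) (\<lambda>_. c)"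
  unfolding p_converges_def p_controlled_def
  by (rule exI[of _ 0], rule exI[of _ "\<lambda>_. 0"]) (auto intro!: exI[of _ "\<lambda>_. 0"] mono_onI)

text \<open>The difference of integrals is that of \<open>fn n - f\<close> against
  \<open>gn n\<close> plus that of \<open>f\<close> against \<open>gn n - g\<close>. Both tend to 0
  by bilinearity, \<open>gn n\<close> being eventually bounded uniformly. The common starting value
  supplies the bound at 0 for the first integrand.\<close>

lemma p_converges_rs_integral:
  assumes p: "1 \<le> p" "p < 2" "0 < T"
    and f: "p_converges p T fn f" and g: "p_converges p T gn g" and f0: "\<And>n. fn n 0 = f 0"
  shows "p_converges p T (\<lambda>n t. rs_integral (fn n) (gn n) 0 t) (\<lambda>t. rs_integral f g 0 t)"
proof -
  obtain M' \<epsilon> where "0 \<le> M'" and \<epsilon>: "\<And>n. 0 \<le> \<epsilon> n" "\<epsilon> \<longlonglongrightarrow> 0" and "p_controlled p T M' f"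
    and fn: "\<forall>\<^sub>F n in sequentially. p_controlled p T (\<epsilon> n) (\<lambda>t. fn n t - f t)"
    using f unfolding p_converges_def by blast
  obtain L \<delta> where L: "0 \<le> L" and \<delta>: "\<And>n. 0 \<le> \<delta> n" "\<delta> \<longlonglongrightarrow> 0" and gL: "p_controlled p T L g"
    and gn: "\<forall>\<^sub>F n in sequentially. p_controlled p T (\<delta> n) (\<lambda>t. gn n t - g t)"
    using g unfolding p_converges_def by blast
  \<comment> \<open>Enlarged so that \<open>M\<close> also bounds \<open>f\<close> at 0, as
    \<open>p_controlled_rs_integral\<close> requires.\<close>
  define M where "M = M' + \<bar>f 0\<bar>"
  have M: "0 \<le> M" "\<bar>f 0\<bar> \<le> M" using \<open>0 \<le> M'\<close> by (auto simp: M_def)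
  have fM: "p_controlled p T M f"
    using \<open>p_controlled p T M' f\<close> by (rule p_controlled_mono) (simp add: M_def)
  let ?K = "integral_const p"
  have K: "0 \<le> ?K"
    using young_const(1)[of "1 / p + 1 / 2"] p by (auto simp: integral_const_def field_simps)
  define \<eta> where "\<eta> n = 2 * (?K * \<epsilon> n * (2 * (\<delta> n + L)) + ?K * M * \<delta> n)" for n
  have "\<forall>\<^sub>F n in sequentially. p_controlled p T (\<eta> n)
      (\<lambda>t. rs_integral (fn n) (gn n) 0 t - rs_integral f g 0 t)"
    using fn gn
  proof eventually_elim
    case (elim n)
    let ?df = "\<lambda>t. fn n t - f t" and ?dg = "\<lambda>t. gn n t - g t"
    have gnL: "p_controlled p T (2 * (\<delta> n + L)) (gn n)"
      using p_controlled_add[OF p \<delta>(1) L elim(2) gL] by simp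
    have fnM: "p_controlled p T (2 * (\<epsilon> n + M)) (fn n)"
      using p_controlled_add[OF p \<epsilon>(1) M(1) elim(1) fM] by simp
    have nonneg: "0 \<le> 2 * (\<delta> n + L)" "0 \<le> 2 * (\<epsilon> n + M)" using \<delta>(1) \<epsilon>(1) M L by auto
    have split: "rs_integral (fn n) (gn n) 0 t - rs_integral f g 0 t =
        rs_integral ?df (gn n) 0 t + rs_integral f ?dg 0 t" if t: "0 \<le> t" "t \<le> T" for t
    proof -
      note int = has_rs_integral_controlled[OF p _ _ _ _ t]
      have 1: "has_rs_integral ?df (gn n) 0 t (rs_integral ?df (gn n) 0 t)"
        using int[OF \<epsilon>(1) nonneg(1) elim(1) gnL] .
      have 2: "has_rs_integral f ?dg 0 t (rs_integral f ?dg 0 t)"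
        using int[OF M(1) \<delta>(1) fM elim(2)] .
      have 3: "has_rs_integral f g 0 t (rs_integral f g 0 t)"
        using int[OF M(1) L fM gL] .
      have 23: "has_rs_integral f (gn n) 0 t (rs_integral f ?dg 0 t + rs_integral f g 0 t)"
        by (rule has_rs_integral_add[OF 2 3]) (simp add: algebra_simps)
      have "has_rs_integral (fn n) (gn n) 0 t
          (rs_integral ?df (gn n) 0 t + (rs_integral f ?dg 0 t + rs_integral f g 0 t))"
        by (rule has_rs_integral_add[OF 1 23]) (simp add: algebra_simps)
      then show ?thesis using t by (simp add: rs_integral_eq)
    qed
    have "p_controlled p T (?K * \<epsilon> n * (2 * (\<delta> n + L))) (\<lambda>t. rs_integral ?df (gn n) 0 t)"
      using p_controlled_rs_integral[OF p \<epsilon>(1) nonneg(1) elim(1) gnL] f0 \<epsilon>(1) by simp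
    moreover have "p_controlled p T (?K * M * \<delta> n) (\<lambda>t. rs_integral f ?dg 0 t)"
      using p_controlled_rs_integral[OF p M(1) \<delta>(1) fM elim(2) M(2)] .
    ultimately have "p_controlled p T (\<eta> n) (\<lambda>t. rs_integral ?df (gn n) 0 t + rs_integral f ?dg 0 t)"
      unfolding \<eta>_def using K M nonneg \<epsilon>(1) \<delta>(1) by (intro p_controlled_add p) auto
    then show ?case
      by (rule p_controlled_cong) (simp add: split)
  qed
  moreover have "\<eta> \<longlonglongrightarrow> 2 * (?K * 0 * (2 * (0 + L)) + ?K * M * 0)"
    unfolding \<eta>_def by (intro tendsto_intros \<epsilon> \<delta>)
  moreover have "0 \<le> \<eta> n" for n
    using K M L \<epsilon>(1) \<delta>(1) by (simp add: \<eta>_def)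
  moreover have "p_controlled p T (?K * M * L) (\<lambda>t. rs_integral f g 0 t)"
    using p_controlled_rs_integral[OF p M(1) L fM gL M(2)] .
  ultimately show ?thesis
    unfolding p_converges_def using K M L
    by (intro exI[of _ "?K * M * L"] exI[of _ \<eta>]) auto
qed

text \<open>With equal starting values the difference at \<open>T\<close> is its own increment over
  [0,T], which \<epsilon> bounds.\<close>

lemma p_converges_tendsto:
  assumes "0 < p" "0 < T" "p_converges p T fn f" "\<And>n. fn n 0 = f 0"
  shows "(\<lambda>n. fn n T) \<longlonglongrightarrow> f T"
proof -
  obtain \<epsilon> where \<epsilon>: "\<And>n. 0 \<le> \<epsilon> n" "\<epsilon> \<longlonglongrightarrow> 0"
    and fn: "\<forall>\<^sub>F n in sequentially. p_controlled p T (\<epsilon> n) (\<lambda>t. fn n t - f t)"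
    using assms(3) unfolding p_converges_def by blast
  have "\<forall>\<^sub>F n in sequentially. norm (fn n T - f T) \<le> \<epsilon> n"
    using fn
  proof eventually_elim
    case (elim n)
    then obtain W where W: "mono_on {0..T} W" "W T - W 0 \<le> 1"
      "\<bar>fn n T - f T - (fn n 0 - f 0)\<bar> \<le> \<epsilon> n * (W T - W 0) powr (1 / p)"
      using assms(2) unfolding p_controlled_def by (metis less_eq_real_def)
    have "0 \<le> W T - W 0" using mono_onD[OF W(1), of 0 T] assms(2) by simp
    then have "(W T - W 0) powr (1 / p) \<le> 1"
      using W(2) assms(1) by (intro powr_le1) auto
    then have "\<epsilon> n * (W T - W 0) powr (1 / p) \<le> \<epsilon> n"
      using \<epsilon>(1) by (simp add: mult_left_le)
    then show ?case using W(3) assms(4) by simp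
  qed
  then have "(\<lambda>n. fn n T - f T) \<longlonglongrightarrow> 0" using \<epsilon>(2) by (rule Lim_null_comparison)
  then show ?thesis by (simp add: LIM_zero_iff)
qed

text \<open>The starting value depends on the word alone, so iterated integrals of different paths
  agree at time 0, as \<open>p_converges_rs_integral\<close> asks of its integrands.\<close>

lemma iterated_integral_zero: "iterated_integral X w 0 = (if w = [] then 1 else 0)"
  by (cases w) (simp_all add: rs_integral_refl)

text \<open>The paths occur only as integrators, hence through increments, and may start at
  different points; the integrands are iterated integrals of shorter words.\<close>

lemma p_converges_iterated_integral:
  assumes "1 \<le> p" "p < 2" "0 < T" "\<And>i. p_converges p T (\<lambda>n t. Xn n t $ i) (\<lambda>t. X t $ i)"
  shows "p_converges p T (\<lambda>n. iterated_integral (Xn n) w) (iterated_integral X w)"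
proof (induction w)
  case Nil
  then show ?case by (simp add: p_converges_const)
next
  case (Cons i w)
  then show ?case
    using p_converges_rs_integral[OF assms(1-3) Cons.IH assms(4)]
    by (simp add: iterated_integral_zero)
qed

lemma p_converges_of_pvar:
  fixes X :: "real \<Rightarrow> real ^ 'd::finite"
  assumes "1 \<le> p" "0 < T" "\<And>n. continuous_on {0..T} (Xn n)" "continuous_on {0..T} X"
    and "pvar p T X < top" "(\<lambda>n. pvar p T (\<lambda>t. Xn n t - X t)) \<longlonglongrightarrow> 0"
  shows "p_converges p T (\<lambda>n t. Xn n t $ i) (\<lambda>t. X t $ i)"
proof -
  \<comment> \<open>The summand 1, like the inverse of \<open>Suc n\<close> below, makes the bound
    positive, as \<open>p_controlled_of_pvar\<close> divides by a power of it.\<close>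
  define M where "M = enn2real (pvar p T X) + 1"
  have "pvar p T X = ennreal (enn2real (pvar p T X))" using assms(5) by simp
  also have "\<dots> \<le> ennreal M" unfolding M_def by (intro ennreal_leI) simp
  finally have "p_controlled p T M (\<lambda>t. X t $ i)"
    using assms by (intro p_controlled_of_pvar) (auto simp: M_def add_nonneg_pos)
  moreover
  define v where "v n = pvar p T (\<lambda>t. Xn n t - X t)" for n
  have v: "v \<longlonglongrightarrow> 0" using assms(6) by (simp add: v_def[abs_def])
  define \<epsilon> where "\<epsilon> n = enn2real (v n) + inverse (real (Suc n))" for n
  have "(\<lambda>n. enn2real (v n)) \<longlonglongrightarrow> 0"
    using tendsto_enn2real[of v 0] v by simp
  then have "\<epsilon> \<longlonglongrightarrow> 0 + 0"
    unfolding \<epsilon>_def by (intro tendsto_add LIMSEQ_inverse_real_of_nat)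
  moreover have "\<forall>\<^sub>F n in sequentially. v n < top"
    using v by (rule order_tendstoD) simp
  then have "\<forall>\<^sub>F n in sequentially. p_controlled p T (\<epsilon> n) (\<lambda>t. Xn n t $ i - X t $ i)"
  proof eventually_elim
    case (elim n)
    then have "v n = ennreal (enn2real (v n))" by simp
    also have "\<dots> \<le> ennreal (\<epsilon> n)" unfolding \<epsilon>_def by (intro ennreal_leI) simp
    finally have "p_controlled p T (\<epsilon> n) (\<lambda>t. (Xn n t - X t) $ i)"
      using assms by (intro p_controlled_of_pvar continuous_on_diff) (auto simp: v_def \<epsilon>_def add_nonneg_pos)
    then show ?case by simp
  qed
  ultimately show ?thesis
    unfolding p_converges_def by (intro exI[of _ M] exI[of _ \<epsilon>]) (auto simp: M_def \<epsilon>_def)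
qed

theorem theorem1p2:
  fixes p T :: real
    and V :: "(real \<times> (real \<Rightarrow> real ^ 'd::finite)) set"
    and Xn :: "nat \<Rightarrow> real \<Rightarrow> real ^ 'd"
    and X :: "real \<Rightarrow> real ^ 'd"
  assumes "1 \<le> p" and "p < 2"
    and "path_variety V"
    and "\<And>n. (T, Xn n) \<in> V"
    and "\<And>n. pvar p T (Xn n) < top"
    and "(T, X) \<in> paths"
    and "pvar p T X < top"
    and "(\<lambda>n. pvar p T (\<lambda>t. Xn n t - X t)) \<longlonglongrightarrow> 0"
  shows "(T, X) \<in> V"
proof -
  obtain W where V: "V = variety W" using assms(3) unfolding path_variety_def by blast
  have "(T, Xn n) \<in> paths" for n using assms(4)[of n] by (simp add: V variety_def)
  then have cont: "continuous_on {0..T} (Xn n)" for n by (simp add: paths_def)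
  have T: "0 < T" "continuous_on {0..T} X" using assms(6) by (simp_all add: paths_def)
  have "p_converges p T (\<lambda>n. iterated_integral (Xn n) w) (iterated_integral X w)" for w
    using assms(1,2,7,8) T cont
    by (intro p_converges_iterated_integral p_converges_of_pvar) auto
  then have lim: "(\<lambda>n. iterated_integral (Xn n) w T) \<longlonglongrightarrow> iterated_integral X w T" for w
    using assms(1) T by (intro p_converges_tendsto[of p]) (auto simp: iterated_integral_zero)
  have "pairing (signature (T, X)) x = 0" if "x \<in> W" for x
  proof (rule LIMSEQ_unique)
    \<comment> \<open>An element \<open>x\<close> is a finite combination of words, so convergence
      of each coordinate suffices; \<open>lim\<close> holds for all words, in particular for
      reversed ones.\<close>
    show "(\<lambda>n. pairing (signature (T, Xn n)) x) \<longlonglongrightarrow> pairing (signature (T, X)) x"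
      unfolding pairing_def signature_def prod.case
      by (intro tendsto_sum tendsto_mult tendsto_const lim)
    have "pairing (signature (T, Xn n)) x = 0" for n
      using assms(4)[of n] that by (simp add: V variety_def)
    then show "(\<lambda>n. pairing (signature (T, Xn n)) x) \<longlonglongrightarrow> 0" by simp
  qed
  then show ?thesis using assms(6) by (simp add: V variety_def)
qed

end
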